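(* For $n\ge 2$ let $a_k$ denote the number of subtrees of the complete graph $K_n$ having exactly $k$ edges ($1\le k\le n-1$), and define the uniform density and the weighted density $$\mu_p(n)=\frac{\sum_{k=1}^{n-1}k a_k}{(n-1)\sum_{k=1}^{n-1}a_k},\qquad \mu_q(n)=\frac{\sum_{k=1}^{n-1}k^2 a_k}{(n-1)\sum_{k=1}^{n-1}k a_k}.$$ Then (1) $\lim_{n\to\infty}\mu_p(n)=1$ and (2) $\lim_{n\to\infty}\mu_q(n)=1$.
   Context: A subtree of a graph is a subgraph that is a tree. By Cayley's formula $a_k=\binom{n}{k+1}(k+1)^{k-1}$. *)

theory Defs
  imports Complex_Main
begin

text \<open>
  Finite simple undirected graphs, given by a vertex set and a set of two-element
  vertex sets. The AFP entry Graph_Theory is not used: it models undirected graphs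
  as symmetric digraphs, in which every edge yields a closed walk a, b, a that counts as
  a cycle, so that its notion of tree is not the undirected one.
\<close>

type_synonym 'a ugraph = "'a set \<times> 'a set set"

abbreviation uverts :: "'a ugraph \<Rightarrow> 'a set" where
  "uverts G \<equiv> fst G"

abbreviation uedges :: "'a ugraph \<Rightarrow> 'a set set" where
  "uedges G \<equiv> snd G"

definition simple_graph :: "'a ugraph \<Rightarrow> bool" where
  "simple_graph G \<longleftrightarrow>
     finite (uverts G) \<and> (\<forall>e\<in>uedges G. e \<subseteq> uverts G \<and> card e = 2)"

definition is_subgraph :: "'a ugraph \<Rightarrow> 'a ugraph \<Rightarrow> bool" where
  "is_subgraph H G \<longleftrightarrow>
     simple_graph H \<and> simple_graph G \<and> uverts H \<subseteq> uverts G \<and> uedges H \<subseteq> uedges G"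

definition graph_walk :: "'a ugraph \<Rightarrow> 'a list \<Rightarrow> bool" where
  "graph_walk G xs \<longleftrightarrow>
     xs \<noteq> [] \<and> set xs \<subseteq> uverts G \<and> successively (\<lambda>u v. {u, v} \<in> uedges G) xs"

definition graph_connected :: "'a ugraph \<Rightarrow> bool" where
  "graph_connected G \<longleftrightarrow>
     uverts G \<noteq> {} \<and>
     (\<forall>u\<in>uverts G. \<forall>v\<in>uverts G. \<exists>xs. graph_walk G xs \<and> hd xs = u \<and> last xs = v)"

text \<open>A cycle is listed without repeating its first vertex at the end.\<close>

definition graph_cycle :: "'a ugraph \<Rightarrow> 'a list \<Rightarrow> bool" where
  "graph_cycle G xs \<longleftrightarrow>
     graph_walk G xs \<and> 3 \<le> length xs \<and> distinct xs \<and> {last xs, hd xs} \<in> uedges G"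

definition is_tree :: "'a ugraph \<Rightarrow> bool" where
  "is_tree G \<longleftrightarrow> simple_graph G \<and> graph_connected G \<and> (\<nexists>xs. graph_cycle G xs)"

definition complete_graph :: "nat \<Rightarrow> nat ugraph" where
  "complete_graph n = ({..<n}, {e. e \<subseteq> {..<n} \<and> card e = 2})"

text \<open>Subtrees are counted as labelled subgraphs, not up to isomorphism.\<close>

definition subtrees :: "'a ugraph \<Rightarrow> nat \<Rightarrow> 'a ugraph set" where
  "subtrees G k = {T. is_subgraph T G \<and> is_tree T \<and> card (uedges T) = k}"

definition num_subtrees :: "nat \<Rightarrow> nat \<Rightarrow> nat" where
  "num_subtrees n k = card (subtrees (complete_graph n) k)"

text \<open>For n < 2 the sums below are empty and both quotients take the value 0.\<close>

definition mu_p :: "nat \<Rightarrow> real" where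
  "mu_p n = (\<Sum>k=1..n-1. real k * real (num_subtrees n k)) /
            ((real n - 1) * (\<Sum>k=1..n-1. real (num_subtrees n k)))"

definition mu_q :: "nat \<Rightarrow> real" where
  "mu_q n = (\<Sum>k=1..n-1. (real k)\<^sup>2 * real (num_subtrees n k)) /
            ((real n - 1) * (\<Sum>k=1..n-1. real k * real (num_subtrees n k)))"

end

theory Submission
  imports Defs
begin

text \<open>
  Cayley's formula is not needed; a crude growth bound on \<open>a\<^sub>k\<close> suffices. Attaching a new
  leaf to a subtree with \<open>k\<close> edges yields a subtree with \<open>k + 1\<close> edges, and the latter
  together with the new leaf determines the former. As a tree with \<open>k\<close> edges has \<open>k + 1\<close>
  vertices, \<open>(n - 1 - k) (k + 1) a\<^sub>k \<le> (k + 2) a\<^bsub>k+1\<^esub>\<close>, hence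
  \<open>(n - 1 - k) a\<^sub>k \<le> 2 a\<^bsub>k+1\<^esub>\<close>. Summing this against the weights \<open>1\<close> and \<open>k\<close> gives
  \<open>1 - 2 / (n - 1) \<le> \<mu> \<le> 1\<close> for both densities.
\<close>

section \<open>Walks and cycles\<close>

text \<open>Connectedness is handled through the reflexive transitive closure of this relation,
  where induction on single steps replaces surgery on lists; cycles remain lists.\<close>

definition adj :: "'a ugraph \<Rightarrow> ('a \<times> 'a) set" where
  "adj G = {(x, y). {x, y} \<in> uedges G}"

lemma simple_graph_edgeD:
  assumes "simple_graph G" "{x, y} \<in> uedges G"
  shows "x \<in> uverts G" "y \<in> uverts G" "x \<noteq> y"
  using assms by (auto simp: simple_graph_def)

lemma graph_walk_imp_rtrancl:
  "graph_walk G xs \<Longrightarrow> (hd xs, last xs) \<in> (adj G)\<^sup>*"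
proof (induction xs rule: induct_list012)
  case (3 x y zs)
  then have "(x, y) \<in> adj G" "graph_walk G (y # zs)"
    by (auto simp: graph_walk_def adj_def)
  with 3 show ?case by (auto intro: converse_rtrancl_into_rtrancl)
qed (auto simp: graph_walk_def)

text \<open>The closure also relates points outside the graph to themselves, hence the membership
  condition on \<open>v\<close>.\<close>

lemma rtrancl_imp_graph_walk:
  assumes "simple_graph G" "v \<in> uverts G" "(u, v) \<in> (adj G)\<^sup>*"
  shows "\<exists>xs. graph_walk G xs \<and> hd xs = u \<and> last xs = v"
  using assms(3)
proof (induction rule: converse_rtrancl_induct)
  case base
  show ?case using assms(2) by (intro exI[of _ "[v]"]) (simp add: graph_walk_def)
next
  case (step y z)
  then obtain xs where xs: "graph_walk G xs" "hd xs = z" "last xs = v" by blast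
  with step(1) have "graph_walk G (y # xs)"
    using simple_graph_edgeD[OF assms(1)] by (auto simp: graph_walk_def adj_def successively_Cons)
  with xs show ?case by (intro exI[of _ "y # xs"]) (auto simp: graph_walk_def)
qed

lemma graph_connected_iff:
  assumes "simple_graph G"
  shows "graph_connected G \<longleftrightarrow>
    uverts G \<noteq> {} \<and> (\<forall>u\<in>uverts G. \<forall>v\<in>uverts G. (u, v) \<in> (adj G)\<^sup>*)"
proof -
  have "(\<exists>xs. graph_walk G xs \<and> hd xs = u \<and> last xs = v) \<longleftrightarrow> (u, v) \<in> (adj G)\<^sup>*"
    if "v \<in> uverts G" for u v
    using rtrancl_imp_graph_walk[OF assms that] by (auto dest: graph_walk_imp_rtrancl)
  then show ?thesis by (simp add: graph_connected_def)
qed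

lemma graph_walk_mono:
  assumes "graph_walk G xs" "set xs \<subseteq> uverts H"
    "\<And>x y. x \<in> set xs \<Longrightarrow> y \<in> set xs \<Longrightarrow> {x, y} \<in> uedges G \<Longrightarrow> {x, y} \<in> uedges H"
  shows "graph_walk H xs"
  using assms by (auto simp: graph_walk_def intro: successively_mono)

lemma graph_cycle_mono:
  assumes "graph_cycle G xs" "set xs \<subseteq> uverts H"
    "\<And>x y. x \<in> set xs \<Longrightarrow> y \<in> set xs \<Longrightarrow> {x, y} \<in> uedges G \<Longrightarrow> {x, y} \<in> uedges H"
  shows "graph_cycle H xs"
proof -
  have "xs \<noteq> []" using assms(1) by (auto simp: graph_cycle_def)
  then have "last xs \<in> set xs" "hd xs \<in> set xs" by auto
  then show ?thesis
    using assms graph_walk_mono[of G xs H] by (simp add: graph_cycle_def)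
qed

text \<open>The two neighbours are the cyclic predecessor and successor of \<open>x\<close>. Thus a
  vertex with a single neighbour lies on no cycle.\<close>

lemma graph_cycle_two_neighbours:
  assumes "graph_cycle G xs" "x \<in> set xs"
  shows "\<exists>y z. y \<noteq> z \<and> {x, y} \<in> uedges G \<and> {x, z} \<in> uedges G"
proof -
  define n where "n = length xs"
  have n: "3 \<le> n" "distinct xs" "xs \<noteq> []" and le: "{last xs, hd xs} \<in> uedges G"
    and suc: "\<And>i. Suc i < n \<Longrightarrow> {xs ! i, xs ! Suc i} \<in> uedges G"
    using assms(1)
    by (auto simp: graph_cycle_def n_def graph_walk_def successively_conv_nth)
  have wrap: "{xs ! (n - 1), xs ! 0} \<in> uedges G"
    using le n by (simp add: last_conv_nth hd_conv_nth n_def)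
  obtain i where i: "i < n" "x = xs ! i" using assms(2) by (auto simp: in_set_conv_nth n_def)
  \<comment> \<open>The cyclic predecessor and successor indices of \<open>i\<close>; they differ
    because \<open>n\<close> is at least 3.\<close>
  define p where "p = (if i = 0 then n - 1 else i - 1)"
  define s where "s = (if Suc i = n then 0 else Suc i)"
  have "p < n" "s < n" "p \<noteq> s" using i(1) n(1) by (auto simp: p_def s_def)
  then have "xs ! p \<noteq> xs ! s" using n(2) by (simp add: nth_eq_iff_index_eq n_def)
  moreover have "{x, xs ! s} \<in> uedges G"
    using i suc[of i] wrap n(1) by (auto simp: s_def insert_commute)
  moreover have "{x, xs ! p} \<in> uedges G"
    using i suc[of "i - 1"] wrap n(1) by (auto simp: p_def insert_commute)
  ultimately show ?thesis by blast
qed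

section \<open>Leaves of trees\<close>

text \<open>The first vertex of a longest path is a leaf: a second neighbour would either extend the
  path or close a cycle with it.\<close>

lemma acyclic_has_leaf:
  assumes G: "simple_graph G" and acyc: "\<nexists>xs. graph_cycle G xs" and "uedges G \<noteq> {}"
  shows "\<exists>x y. {x, y} \<in> uedges G \<and> (\<forall>z. {x, z} \<in> uedges G \<longrightarrow> z = y)"
proof -
  define P where "P p \<longleftrightarrow> graph_walk G p \<and> distinct p" for p
  obtain e where e: "e \<in> uedges G" using assms(3) by blast
  then have "card e = 2" using G by (simp add: simple_graph_def)
  then obtain a b where ab: "{a, b} \<in> uedges G" using e by (metis card_2_iff)
  then have "P [a, b]"
    using simple_graph_edgeD[OF G ab] by (simp add: P_def graph_walk_def)
  \<comment> \<open>A path repeats no vertex, so path lengths are bounded and a longest path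
    exists.\<close>
  moreover have "\<forall>p. P p \<longrightarrow> length p < Suc (card (uverts G))"
    using G by (auto simp: P_def graph_walk_def simple_graph_def less_Suc_eq_le
        simp flip: distinct_card intro: card_mono)
  ultimately obtain p where p: "P p" and max: "\<And>q. P q \<Longrightarrow> length q \<le> length p"
    using ex_has_greatest_nat[of P "[a, b]" length "Suc (card (uverts G))"] by blast
  have "2 \<le> length p" using max[OF \<open>P [a, b]\<close>] by simp
  then obtain x y ys where xy: "p = x # y # ys"
    by (cases p; cases "tl p") auto
  have "z = y" if z: "{x, z} \<in> uedges G" for z
  proof (rule ccontr)
    assume "z \<noteq> y"
    note zG = simple_graph_edgeD[OF G z]
    have "z \<in> set p"
    proof (rule ccontr)
      assume "z \<notin> set p"
      then have "P (z # p)"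
        using p z zG by (auto simp: P_def xy graph_walk_def insert_commute)
      with max[of "z # p"] show False by simp
    qed
    then obtain i where i: "i < length p" "z = p ! i" by (auto simp: in_set_conv_nth)
    \<comment> \<open>\<open>z\<close> is neither \<open>x\<close> (there are no loops) nor
      \<open>y\<close>, so it occurs at index 2 or later, and the path from \<open>x\<close> to
      \<open>z\<close> has the three vertices that a cycle requires.\<close>
    with zG \<open>z \<noteq> y\<close> have i2: "2 \<le> i"
      by (cases i; cases "i - 1") (auto simp: xy)
    have "graph_walk G (take (Suc i) p)"
      using p by (auto simp: P_def graph_walk_def successively_conv_nth dest: in_set_takeD)
    moreover have "last (take (Suc i) p) = z"
      using i by (simp add: take_Suc_conv_app_nth)
    moreover have "hd (take (Suc i) p) = x" by (simp add: xy)
    moreover have "distinct (take (Suc i) p)" "3 \<le> length (take (Suc i) p)"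
      using p i i2 by (simp_all add: P_def)
    moreover have "{z, x} \<in> uedges G" using z by (simp add: insert_commute)
    ultimately have "graph_cycle G (take (Suc i) p)" by (simp add: graph_cycle_def)
    with acyc show False by blast
  qed
  moreover have "{x, y} \<in> uedges G" using p by (simp add: P_def xy graph_walk_def)
  ultimately show ?thesis by blast
qed

definition remove_vertex :: "'a \<Rightarrow> 'a ugraph \<Rightarrow> 'a ugraph" where
  "remove_vertex v G = (uverts G - {v}, {e \<in> uedges G. v \<notin> e})"

lemma is_tree_remove_leaf:
  assumes T: "is_tree T" and xy: "{x, y} \<in> uedges T"
    and uniq: "\<And>z. {x, z} \<in> uedges T \<Longrightarrow> z = y"
  shows "is_tree (remove_vertex x T)" "uedges T = insert {x, y} (uedges (remove_vertex x T))"
proof -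
  let ?T = "remove_vertex x T"
  have sT: "simple_graph T" and acyc: "\<nexists>xs. graph_cycle T xs"
    and conn: "\<And>u v. u \<in> uverts T \<Longrightarrow> v \<in> uverts T \<Longrightarrow> (u, v) \<in> (adj T)\<^sup>*"
    using T by (auto simp: is_tree_def graph_connected_iff)
  note xyT = simple_graph_edgeD[OF sT xy]
  have s: "simple_graph ?T" using sT by (auto simp: simple_graph_def remove_vertex_def)
  have "e = {x, y}" if e: "e \<in> uedges T" "x \<in> e" for e
  proof -
    have "card e = 2" using sT e by (auto simp: simple_graph_def)
    then obtain z where "e = {x, z}" using e(2) by (auto simp: card_2_iff)
    with uniq e(1) show ?thesis by blast
  qed
  then show "uedges T = insert {x, y} (uedges ?T)"
    using xy unfolding remove_vertex_def snd_conv by blast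
  \<comment> \<open>Folding the leaf onto its neighbour turns walks of \<^term>\<open>T\<close> into walks of \<^term>\<open>remove_vertex x T\<close>.\<close>
  define f where "f z = (if z = x then y else z)" for z
  have fold: "(f u, f v) \<in> (adj ?T)\<^sup>*" if "(u, v) \<in> (adj T)\<^sup>*" for u v
    using that
  proof (induction rule: rtrancl_induct)
    case (step v w)
    then have vw: "{v, w} \<in> uedges T" by (simp add: adj_def)
    have "f v = f w \<or> (f v, f w) \<in> adj ?T"
    proof (cases "v = x \<or> w = x")
      case True
      then have "{v, w} = {x, y}" using vw uniq by (metis insert_commute)
      then show ?thesis by (auto simp: f_def doubleton_eq_iff)
    next
      case False
      then show ?thesis using vw by (auto simp: f_def adj_def remove_vertex_def)
    qed
    with step.IH show ?case by (auto intro: rtrancl_into_rtrancl)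
  qed simp
  have "(u, v) \<in> (adj ?T)\<^sup>*" if "u \<in> uverts ?T" "v \<in> uverts ?T" for u v
  proof -
    have "u \<in> uverts T" "v \<in> uverts T" "f u = u" "f v = v"
      using that by (auto simp: remove_vertex_def f_def)
    then show ?thesis using fold[OF conn, of u v] by simp
  qed
  moreover have "y \<in> uverts ?T" using xyT by (auto simp: remove_vertex_def)
  ultimately have "graph_connected ?T" by (auto simp: graph_connected_iff[OF s])
  moreover have "graph_cycle T xs" if c: "graph_cycle ?T xs" for xs
  proof (rule graph_cycle_mono[OF c])
    show "set xs \<subseteq> uverts T"
      using c by (auto simp: graph_cycle_def graph_walk_def remove_vertex_def)
  qed (auto simp: remove_vertex_def)
  ultimately show "is_tree ?T" using s acyc by (auto simp: is_tree_def)
qed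

text \<open>Induction by deleting a leaf, which removes exactly one vertex and one edge.\<close>

lemma card_uverts_tree:
  assumes "is_tree T"
  shows "card (uverts T) = Suc (card (uedges T))"
  using assms
proof (induction "card (uverts T)" arbitrary: T rule: less_induct)
  case less
  note T = less.prems
  have s: "simple_graph T" and fin: "finite (uverts T)" and ne: "uverts T \<noteq> {}"
    and conn: "\<And>u v. u \<in> uverts T \<Longrightarrow> v \<in> uverts T \<Longrightarrow> (u, v) \<in> (adj T)\<^sup>*"
    using T by (auto simp: is_tree_def graph_connected_iff simple_graph_def)
  show ?case
  proof (cases "uedges T = {}")
    case True
    \<comment> \<open>Without edges the closure is the identity, so connectedness leaves a single
      vertex.\<close>
    then have "adj T = {}" by (simp add: adj_def)
    with conn ne obtain v where "uverts T = {v}" by fastforce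
    then show ?thesis using True by simp
  next
    case False
    then obtain x y where xy: "{x, y} \<in> uedges T" and uniq: "\<And>z. {x, z} \<in> uedges T \<Longrightarrow> z = y"
      using acyclic_has_leaf[OF s] T by (auto simp: is_tree_def)
    let ?T = "remove_vertex x T"
    note rem = is_tree_remove_leaf[OF T xy uniq]
    have x: "x \<in> uverts T" using simple_graph_edgeD[OF s xy] by simp
    have V: "card (uverts T) = Suc (card (uverts ?T))"
      using card.remove[OF fin x] by (simp add: remove_vertex_def)
    have "finite (uedges T)"
      using s by (auto simp: simple_graph_def intro: finite_subset[of _ "Pow (uverts T)"])
    then have "finite (uedges ?T)" "{x, y} \<notin> uedges ?T" by (auto simp: remove_vertex_def)
    then have "card (uedges T) = Suc (card (uedges ?T))" using rem(2) card_insert_disjoint by metis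
    then show ?thesis using V less.hyps[OF _ rem(1)] by simp
  qed
qed

definition add_leaf :: "'a \<Rightarrow> 'a \<Rightarrow> 'a ugraph \<Rightarrow> 'a ugraph" where
  "add_leaf u v G = (insert v (uverts G), insert {u, v} (uedges G))"

text \<open>Source of injectivity in the counting below: the extended tree together with its new
  leaf determines the original tree.\<close>

lemma remove_vertex_add_leaf:
  assumes "simple_graph G" "v \<notin> uverts G"
  shows "remove_vertex v (add_leaf u v G) = G"
  using assms by (cases G) (auto simp: remove_vertex_def add_leaf_def simple_graph_def)

text \<open>The only neighbour of \<open>v\<close> is \<open>u\<close>, so no cycle passes through
  \<open>v\<close>, and every cycle would already be one of \<open>T\<close>.\<close>

lemma is_tree_add_leaf:
  assumes T: "is_tree T" and u: "u \<in> uverts T" and v: "v \<notin> uverts T"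
  shows "is_tree (add_leaf u v T)"
proof -
  let ?T = "add_leaf u v T"
  have sT: "simple_graph T" and acyc: "\<nexists>xs. graph_cycle T xs"
    and conn: "\<And>a b. a \<in> uverts T \<Longrightarrow> b \<in> uverts T \<Longrightarrow> (a, b) \<in> (adj T)\<^sup>*"
    using T by (auto simp: is_tree_def graph_connected_iff)
  have uv: "u \<noteq> v" using u v by blast
  have vT: "{v, y} \<notin> uedges T" for y using simple_graph_edgeD(1)[OF sT] v by blast
  have s: "simple_graph ?T" using sT u uv by (auto simp: simple_graph_def add_leaf_def)
  have "adj T \<subseteq> adj ?T" by (auto simp: adj_def add_leaf_def)
  then have conn': "(a, b) \<in> (adj ?T)\<^sup>*" if "a \<in> uverts T" "b \<in> uverts T" for a b
    using conn[OF that] rtrancl_mono by blast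
  have "(u, v) \<in> adj ?T" "(v, u) \<in> adj ?T" by (auto simp: adj_def add_leaf_def insert_commute)
  then have "(a, b) \<in> (adj ?T)\<^sup>*" if "a \<in> uverts ?T" "b \<in> uverts ?T" for a b
    using that conn' u unfolding add_leaf_def
    by (auto intro: rtrancl_into_rtrancl converse_rtrancl_into_rtrancl)
  moreover have "uverts ?T \<noteq> {}" by (simp add: add_leaf_def)
  ultimately have "graph_connected ?T" by (simp add: graph_connected_iff[OF s])
  moreover have False if c: "graph_cycle ?T xs" for xs
  proof (cases "v \<in> set xs")
    case True
    from graph_cycle_two_neighbours[OF c this] vT uv show False
      by (auto simp: add_leaf_def doubleton_eq_iff)
  next
    case False
    have "graph_cycle T xs"
    proof (rule graph_cycle_mono[OF c])
      show "set xs \<subseteq> uverts T"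
        using c False by (auto simp: graph_cycle_def graph_walk_def add_leaf_def)
    qed (use False in \<open>auto simp: add_leaf_def doubleton_eq_iff\<close>)
    with acyc show False by blast
  qed
  ultimately show ?thesis using s by (auto simp: is_tree_def)
qed

section \<open>Growth of the number of subtrees\<close>

lemma is_subgraph_complete_graph_iff:
  "is_subgraph T (complete_graph n) \<longleftrightarrow> simple_graph T \<and> uverts T \<subseteq> {..<n}"
  by (force simp: is_subgraph_def complete_graph_def simple_graph_def)

lemma subtrees_complete_graph:
  "subtrees (complete_graph n) k = {T. is_tree T \<and> uverts T \<subseteq> {..<n} \<and> card (uedges T) = k}"
  by (auto simp: subtrees_def is_subgraph_complete_graph_iff is_tree_def)

lemma finite_subtrees_complete_graph: "finite (subtrees (complete_graph n) k)"
proof (rule finite_subset)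
  show "subtrees (complete_graph n) k \<subseteq> Pow {..<n} \<times> Pow (Pow {..<n})"
    by (fastforce simp: subtrees_complete_graph is_tree_def simple_graph_def)
qed auto

lemma num_subtrees_leaf_bound:
  "(k + 1) * (n - 1 - k) * num_subtrees n k \<le> (k + 2) * num_subtrees n (k + 1)"
proof -
  let ?S = "\<lambda>k. subtrees (complete_graph n) k"
  \<comment> \<open>\<open>A\<close> consists of a tree, an attachment vertex in it and a new vertex
    outside it. \<open>B\<close> pairs a larger tree with any of its vertices, leaf or not, so the
    injection yields only an inequality.\<close>
  define A where "A = (SIGMA T : ?S k. uverts T \<times> ({..<n} - uverts T))"
  define B where "B = (SIGMA T : ?S (k + 1). uverts T)"
  define f where "f = (\<lambda>(T, u, v). (add_leaf u v T, v :: nat))"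
  have S: "finite (uverts T)" "card (uverts T) = Suc k" if "T \<in> ?S k" for T k
    using that card_uverts_tree[of T]
    by (auto simp: subtrees_complete_graph is_tree_def simple_graph_def)
  have "card A = (\<Sum>T\<in>?S k. card (uverts T) * card ({..<n} - uverts T))"
    unfolding A_def using finite_subtrees_complete_graph S
    by (subst card_SigmaI) (auto simp: card_cartesian_product)
  also have "\<dots> = (\<Sum>T\<in>?S k. (k + 1) * (n - 1 - k))"
    by (intro sum.cong refl) (auto simp: S card_Diff_subset subtrees_complete_graph)
  finally have cardA: "card A = (k + 1) * (n - 1 - k) * num_subtrees n k"
    by (simp add: num_subtrees_def)
  have "card B = (\<Sum>T\<in>?S (k + 1). card (uverts T))"
    unfolding B_def using finite_subtrees_complete_graph S by (subst card_SigmaI) auto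
  also have "\<dots> = (\<Sum>T\<in>?S (k + 1). k + 2)"
    by (intro sum.cong refl) (simp add: S)
  finally have cardB: "card B = (k + 2) * num_subtrees n (k + 1)"
    by (simp add: num_subtrees_def)
  have "finite B"
    unfolding B_def by (intro finite_SigmaI finite_subtrees_complete_graph S(1))
  moreover have "inj_on f A"
  proof (rule inj_onI)
    fix p q assume pq: "p \<in> A" "q \<in> A" "f p = f q"
    obtain T u v where p: "p = (T, u, v)" by (cases p)
    obtain T' u' v' where q: "q = (T', u', v')" by (cases q)
    have T: "simple_graph T" "u \<in> uverts T" "v \<notin> uverts T"
      and T': "simple_graph T'" "u' \<in> uverts T'" "v' \<notin> uverts T'"
      using pq(1,2) by (auto simp: A_def p q subtrees_complete_graph is_tree_def)
    have v: "v' = v" and eq: "add_leaf u v T = add_leaf u' v T'"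
      using pq(3) by (auto simp: f_def p q)
    \<comment> \<open>Deleting \<open>v\<close> from the common image recovers the tree;
      \<open>u\<close> is then read off from the one added edge.\<close>
    have TT: "T' = T"
      using remove_vertex_add_leaf[OF T(1,3), of u] remove_vertex_add_leaf[OF T'(1,3), of u'] eq v
      by metis
    have "{u, v} \<in> insert {u', v} (uedges T)" using eq TT by (auto simp: add_leaf_def)
    moreover have "{u, v} \<notin> uedges T" using simple_graph_edgeD(2)[OF T(1)] T(3) by blast
    ultimately have "u' = u" by (auto simp: doubleton_eq_iff)
    then show "p = q" by (simp add: p q v TT)
  qed
  moreover have "f ` A \<subseteq> B"
  proof (rule image_subsetI)
    fix p assume "p \<in> A"
    then obtain T u v where p: "p = (T, u, v)" and T: "T \<in> ?S k" "u \<in> uverts T"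
      "v \<notin> uverts T" "v < n"
      by (auto simp: A_def)
    have t: "is_tree T" "is_tree (add_leaf u v T)"
      using T by (auto simp: subtrees_complete_graph intro: is_tree_add_leaf)
    have "card (uverts (add_leaf u v T)) = Suc (card (uverts T))"
      using T S(1)[OF T(1)] by (simp add: add_leaf_def)
    then have "card (uedges (add_leaf u v T)) = k + 1"
      using card_uverts_tree[OF t(2)] S(2)[OF T(1)] by simp
    then show "f p \<in> B"
      using t T by (auto simp: B_def f_def p subtrees_complete_graph add_leaf_def)
  qed
  ultimately have "card A \<le> card B" by (metis card_inj_on_le)
  then show ?thesis by (simp add: cardA cardB)
qed

text \<open>Uses \<open>k + 2 \<le> 2 * (k + 1)\<close> and cancels the positive factor
  \<open>k + 1\<close>.\<close>

lemma num_subtrees_growth: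
  "(n - 1 - k) * num_subtrees n k \<le> 2 * num_subtrees n (k + 1)"
proof -
  have "(k + 1) * ((n - 1 - k) * num_subtrees n k) \<le> (k + 2) * num_subtrees n (k + 1)"
    using num_subtrees_leaf_bound[of k n] by (simp only: mult.assoc)
  also have "\<dots> \<le> (k + 1) * (2 * num_subtrees n (k + 1))"
    by (simp add: algebra_simps)
  finally show ?thesis by (simp only: mult_le_cancel1)
qed

text \<open>Makes the denominators of both densities positive. It follows from the growth bound at
  \<open>k = 0\<close>, since a single vertex is a subtree without edges.\<close>

lemma num_subtrees_1_pos:
  assumes "n \<ge> 2"
  shows "num_subtrees n 1 > 0"
proof -
  have "graph_walk ({0 :: nat}, {}) xs \<Longrightarrow> \<not> 3 \<le> length xs" for xs
    by (auto simp: graph_walk_def successively_conv_nth dest: spec[of _ 0])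
  then have "is_tree ({0 :: nat}, {})"
    by (auto simp: is_tree_def simple_graph_def graph_connected_iff graph_cycle_def)
  then have "({0}, {}) \<in> subtrees (complete_graph n) 0"
    using assms by (simp add: subtrees_complete_graph)
  then have "num_subtrees n 0 > 0"
    unfolding num_subtrees_def using finite_subtrees_complete_graph card_gt_0_iff by blast
  then have "(n - 1 - 0) * num_subtrees n 0 > 0" using assms by simp
  with num_subtrees_growth[of n 0] show ?thesis by (intro Nat.gr0I) simp
qed

section \<open>Limits of the densities\<close>

text \<open>Serves both densities, with \<open>w k\<close> equal to the number of subtrees or to
  \<open>k\<close> times that number. The deficit \<open>N - k\<close>, summed against
  \<open>w\<close>, is at most twice the total weight, because growth shifts each term to the next
  index.\<close>

lemma weighted_mean_bounds:
  fixes w :: "nat \<Rightarrow> real"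
  assumes nonneg: "\<And>k. 0 \<le> w k" and pos: "w 1 > 0" and N: "N \<ge> 1"
    and growth: "\<And>k. 1 \<le> k \<Longrightarrow> k < N \<Longrightarrow> (real N - real k) * w k \<le> 2 * w (k + 1)"
  defines "m \<equiv> (\<Sum>k=1..N. real k * w k) / (real N * (\<Sum>k=1..N. w k))"
  shows "1 - 2 / real N \<le> m" "m \<le> 1"
proof -
  let ?W = "\<Sum>k=1..N. w k" and ?K = "\<Sum>k=1..N. real k * w k"
  have W: "?W > 0" using N pos nonneg by (intro sum_pos2[of _ 1]) auto
  have "?K \<le> (\<Sum>k=1..N. real N * w k)"
    using nonneg by (intro sum_mono mult_right_mono) auto
  then have "?K \<le> real N * ?W" by (simp add: sum_distrib_left)
  then show "m \<le> 1" using W N by (simp add: m_def divide_simps)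
  have "real N * ?W - ?K = (\<Sum>k=1..N. (real N - real k) * w k)"
    by (simp add: sum_distrib_left sum_subtractf algebra_simps)
  \<comment> \<open>The term \<open>k = N\<close> vanishes; dropping it leaves only indices where
    \<open>growth\<close> applies.\<close>
  also have "\<dots> = (\<Sum>k=1..<N. (real N - real k) * w k)"
    using N by (intro sum.mono_neutral_right) auto
  also have "\<dots> \<le> (\<Sum>k=1..<N. 2 * w (k + 1))"
    using growth by (intro sum_mono) auto
  \<comment> \<open>After the shift the indices run from 2 to \<open>N\<close>, so the sum is part
    of twice the total weight.\<close>
  also have "\<dots> = (\<Sum>k=Suc 1..<Suc N. 2 * w k)"
    by (subst sum.shift_bounds_Suc_ivl) simp
  also have "\<dots> \<le> (\<Sum>k=1..N. 2 * w k)"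
    using nonneg by (intro sum_mono2) auto
  finally have "(real N - 2) * ?W \<le> ?K" by (simp add: left_diff_distrib flip: sum_distrib_left)
  then have "(real N - 2) / real N \<le> m"
    using W N by (simp add: m_def divide_le_eq le_divide_eq mult_ac)
  then show "1 - 2 / real N \<le> m" using N by (simp add: diff_divide_distrib)
qed

lemma tendsto_1_of_mean_bounds:
  fixes m :: "nat \<Rightarrow> real"
  assumes "\<And>n. n \<ge> 2 \<Longrightarrow> 1 - 2 / real (n - 1) \<le> m n \<and> m n \<le> 1"
  shows "m \<longlonglongrightarrow> 1"
proof (rule tendsto_sandwich[of "\<lambda>n. 1 - 2 / real (n - 1)" _ _ "\<lambda>_. 1"])
  have "(\<lambda>n. 1 - 2 / real n) \<longlonglongrightarrow> 1 - 0"
    by (intro tendsto_diff tendsto_const lim_const_over_n)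
  then show "(\<lambda>n. 1 - 2 / real (n - 1)) \<longlonglongrightarrow> 1"
    by (subst filterlim_sequentially_Suc[symmetric]) simp
qed (use assms in \<open>auto intro: eventually_sequentiallyI[of 2]\<close>)

theorem theorem1p2:
  shows "mu_p \<longlonglongrightarrow> 1 \<and> mu_q \<longlonglongrightarrow> 1"
proof
  have growth: "(real (n - 1) - real k) * real (num_subtrees n k) \<le> 2 * real (num_subtrees n (k + 1))"
    if "k < n - 1" for n k
  proof -
    have "real ((n - 1 - k) * num_subtrees n k) \<le> real (2 * num_subtrees n (k + 1))"
      using num_subtrees_growth by (simp only: of_nat_le_iff)
    \<comment> \<open>Since \<open>k < n - 1\<close>, the truncated difference of naturals agrees
      with the real one.\<close>
    then show ?thesis using that by (simp only: of_nat_mult of_nat_diff less_imp_le of_nat_numeral)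
  qed
  show "mu_p \<longlonglongrightarrow> 1"
  proof (rule tendsto_1_of_mean_bounds)
    fix n :: nat assume n: "n \<ge> 2"
    define a where "a k = real (num_subtrees n k)" for k
    have "mu_p n = (\<Sum>k=1..n-1. real k * a k) / (real (n - 1) * (\<Sum>k=1..n-1. a k))"
      using n by (simp add: mu_p_def a_def of_nat_diff)
    moreover have "0 \<le> a k" "0 < a 1" for k
      using num_subtrees_1_pos[OF n] by (simp_all add: a_def)
    moreover have "(real (n - 1) - real k) * a k \<le> 2 * a (k + 1)" if "k < n - 1" for k
      unfolding a_def using that by (rule growth)
    ultimately show "1 - 2 / real (n - 1) \<le> mu_p n \<and> mu_p n \<le> 1"
      using weighted_mean_bounds[of a "n - 1"] n by simp
  qed
  show "mu_q \<longlonglongrightarrow> 1"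
  proof (rule tendsto_1_of_mean_bounds)
    fix n :: nat assume n: "n \<ge> 2"
    define a where "a k = real k * real (num_subtrees n k)" for k
    have "mu_q n = (\<Sum>k=1..n-1. real k * a k) / (real (n - 1) * (\<Sum>k=1..n-1. a k))"
      using n by (simp add: mu_q_def a_def of_nat_diff power2_eq_square mult.assoc)
    moreover have "0 \<le> a k" "0 < a 1" for k
      using num_subtrees_1_pos[OF n] by (simp_all add: a_def)
    moreover have "(real (n - 1) - real k) * a k \<le> 2 * a (k + 1)" if "k < n - 1" for k
    proof -
      \<comment> \<open>The extra weight increases from \<open>k\<close> to \<open>k + 1\<close>, so
        the growth bound keeps its constant 2.\<close>
      have "real k * ((real (n - 1) - real k) * real (num_subtrees n k))
          \<le> real (k + 1) * (2 * real (num_subtrees n (k + 1)))"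
        using that by (intro mult_mono growth) auto
      then show ?thesis by (simp only: a_def mult_ac)
    qed
    ultimately show "1 - 2 / real (n - 1) \<le> mu_q n \<and> mu_q n \<le> 1"
      using weighted_mean_bounds[of a "n - 1"] n by simp
  qed
qed

end
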